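(* Let $T$ be an $n\times n$ complex matrix with $\|T\|<1$ (operator norm), and let $\widehat{T}$ be a fractured Nelson dilation of $T$. Then at least one of the following must occur: (i) $\widehat{T}$ is eigenvalue entangled, in the sense that its eigenvalue function $\sigma(\widehat{T}(z))$ cannot be partitioned into nontrivial, continuous $k$-valued and $(n-k)$-valued functions $\Lambda_1(z)$ and $\Lambda_2(z)$ (with $1\le k\le n-1$) such that $\Lambda_1(z)\cap\Lambda_2(z)=\emptyset$ for all $z\in\mathbb{D}_T$. (ii) $\widehat{T}$ is subspace reducible, in the sense that there is a nontrivial subspace $S$, $\{0\}\subsetneq S\subsetneq\mathbb{C}^n$, that is reducing for the matrix $\widehat{T}(z)$ (i.e. invariant under both $\widehat{T}(z)$ and $\widehat{T}(z)^*$) for all $z\in\mathbb{D}_T$.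
   Context: $\mathbb{D}$ is the open unit disk and $\mathbb{T}$ the unit circle in $\mathbb{C}$. Nelson dilation: Let $T$ be an $n\times n$ complex matrix with $\|T\|<1$. Write $T=U\,\mathrm{diag}(s_1,\dots,s_n)\,V^*$ with $U,V$ unitary and (phased) singular values $s_1,\dots,s_n\in\mathbb{D}$ (the $s_i$ may be complex). Let $b_1,\dots,b_n$ be automorphisms of $\mathbb{D}$, $b_i(z)=\lambda_i\frac{z+a_i}{1+\bar a_i z}$ with $\lambda_i\in\mathbb{T}$, $a_i\in\mathbb{D}$, such that $b_i(0)=s_i$ for all $i$. Any matrix-valued function of the form $\widehat{T}(z)=U\,\mathrm{diag}(b_1(z),\dots,b_n(z))\,V^*$ arising this way is called a Nelson dilation of $T$; it satisfies $\widehat{T}(0)=T$. Let $\mathbb{D}_T$ be the largest open disk centered at $0$ on which every $b_i$ is analytic (all of $\mathbb{C}$ if every $a_i=0$); then $\overline{\mathbb{D}}\subseteq\mathbb{D}_T$. The exceptional set of $\widehat{T}$ is $S_{\widehat{T}}=\{z\in\mathbb{D}_T:\widehat{T}(z)\text{ has a repeated eigenvalue}\}$, where a repeated eigenvalue is a multiple root of the characteristic polynomial. $\widehat{T}$ is called fractured if $S_{\widehat{T}}$ is finite. The eigenvalue function $\sigma(\widehat{T}(z))$ is the $n$-valued function on $\mathbb{D}_T$ assigning to $z$ the $n$ roots, counted with multiplicity, of $\det(xI-\widehat{T}(z))=0$. A $k$-valued function assigns to each $z\in\mathbb{D}_T$ an unordered $k$-tuple (multiset) of complex numbers; continuity is with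 respect to the usual topology on unordered $k$-tuples. Being partitioned into $\Lambda_1,\Lambda_2$ means that, for each $z\in\mathbb{D}_T$, $\sigma(\widehat{T}(z))$ is the multiset union of $\Lambda_1(z)$ and $\Lambda_2(z)$. *)

theory Defs
  imports "HOL-Analysis.Analysis" "HOL-Computational_Algebra.Polynomial" "HOL-Library.Multiset"
begin

definition adj :: "complex^'n^'m \<Rightarrow> complex^'m^'n" where
  "adj A = (\<chi> i j. cnj (A $ j $ i))"

definition unitary :: "complex^'n^'n \<Rightarrow> bool" where
  "unitary U \<longleftrightarrow> U ** adj U = mat 1 \<and> adj U ** U = mat 1"

definition diag :: "('n \<Rightarrow> 'a::zero) \<Rightarrow> 'a^'n^'n" where
  "diag d = (\<chi> i j. if i = j then d i else 0)"

text \<open>The characteristic polynomial, as a determinant over the ring of polynomials.\<close>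

definition charpoly :: "complex^'n^'n \<Rightarrow> complex poly" where
  "charpoly A = det (mat [:0, 1:] - (\<chi> i j. [:A $ i $ j:]))"

definition eigenvalues :: "complex^'n^'n \<Rightarrow> complex multiset" where
  "eigenvalues A = proots (charpoly A)"

definition has_repeated_eigenvalue :: "complex^'n^'n \<Rightarrow> bool" where
  "has_repeated_eigenvalue A \<longleftrightarrow> (\<exists>x. order x (charpoly A) \<ge> 2)"


definition disk_aut :: "complex \<Rightarrow> complex \<Rightarrow> complex \<Rightarrow> complex" where
  "disk_aut \<mu> a z = \<mu> * ((z + a) / (1 + cnj a * z))"

text \<open>
  \<^term>\<open>nelson_data T U V s \<mu> a\<close> says that the listed data give rise to a Nelson dilation of \<^term>\<open>T\<close>,
  namely \<^term>\<open>nelson_dilation U V \<mu> a\<close> below. The numbers \<^term>\<open>s i\<close> are the phased singular values.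
\<close>

definition nelson_data ::
  "complex^'n^'n \<Rightarrow> complex^'n^'n \<Rightarrow> complex^'n^'n \<Rightarrow>
   ('n \<Rightarrow> complex) \<Rightarrow> ('n \<Rightarrow> complex) \<Rightarrow> ('n \<Rightarrow> complex) \<Rightarrow> bool" where
  "nelson_data T U V s \<mu> a \<longleftrightarrow>
     unitary U \<and> unitary V \<and> T = U ** diag s ** adj V \<and>
     (\<forall>i. s i \<in> ball 0 1 \<and> \<mu> i \<in> sphere 0 1 \<and> a i \<in> ball 0 1 \<and> disk_aut (\<mu> i) (a i) 0 = s i)"

definition nelson_dilation ::
  "complex^'n^'n \<Rightarrow> complex^'n^'n \<Rightarrow> ('n \<Rightarrow> complex) \<Rightarrow> ('n \<Rightarrow> complex) \<Rightarrow>
   complex \<Rightarrow> complex^'n^'n" where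
  "nelson_dilation U V \<mu> a z = U ** diag (\<lambda>i. disk_aut (\<mu> i) (a i) z) ** adj V"

text \<open>
  The largest open disk centred at 0 on which every factor is analytic, obtained as the union of
  all such disks (hence the whole plane if every \<^term>\<open>a i\<close> is 0). At its pole, \<^const>\<open>disk_aut\<close>
  takes the value 0 by the convention for division, but it is not analytic there.
\<close>

definition nelson_domain :: "('n \<Rightarrow> complex) \<Rightarrow> ('n \<Rightarrow> complex) \<Rightarrow> complex set" where
  "nelson_domain \<mu> a = \<Union>{ball 0 r | r. \<forall>i. disk_aut (\<mu> i) (a i) analytic_on ball 0 r}"


definition exceptional_set :: "complex set \<Rightarrow> (complex \<Rightarrow> complex^'n^'n) \<Rightarrow> complex set" where
  "exceptional_set D F = {z \<in> D. has_repeated_eigenvalue (F z)}"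

definition fractured :: "complex set \<Rightarrow> (complex \<Rightarrow> complex^'n^'n) \<Rightarrow> bool" where
  "fractured D F \<longleftrightarrow> finite (exceptional_set D F)"

text \<open>
  Continuity of a \<open>k\<close>-valued function, for the matching metric on unordered \<open>k\<close>-tuples:
  \<^term>\<open>rel_mset (\<lambda>x y. dist x y < e) M N\<close> says that \<^term>\<open>M\<close> and \<^term>\<open>N\<close> can be listed so that
  corresponding entries are closer than \<^term>\<open>e\<close>. This metric induces the quotient topology
  of the space of ordered \<open>k\<close>-tuples modulo permutations.
\<close>

definition continuous_multivalued :: "complex set \<Rightarrow> nat \<Rightarrow> (complex \<Rightarrow> complex multiset) \<Rightarrow> bool" where
  "continuous_multivalued D k \<Lambda> \<longleftrightarrow>
     (\<forall>z\<in>D. size (\<Lambda> z) = k) \<and>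
     (\<forall>z\<in>D. \<forall>e>0. \<exists>d>0. \<forall>w\<in>D. dist z w < d \<longrightarrow> rel_mset (\<lambda>x y. dist x y < e) (\<Lambda> z) (\<Lambda> w))"

definition eigenvalue_entangled :: "complex set \<Rightarrow> (complex \<Rightarrow> complex^'n^'n) \<Rightarrow> bool" where
  "eigenvalue_entangled D F \<longleftrightarrow>
     \<not> (\<exists>k \<Lambda>1 \<Lambda>2. 1 \<le> k \<and> k \<le> CARD('n) - 1 \<and>
          continuous_multivalued D k \<Lambda>1 \<and>
          continuous_multivalued D (CARD('n) - k) \<Lambda>2 \<and>
          (\<forall>z\<in>D. eigenvalues (F z) = \<Lambda>1 z + \<Lambda>2 z) \<and>
          (\<forall>z\<in>D. \<Lambda>1 z \<inter># \<Lambda>2 z = {#}))"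

text \<open>
  \<^const>\<open>vec.subspace\<close> is the notion of subspace over the scalar field of the vectors, here the
  complex numbers (\<^const>\<open>subspace\<close> would mean real subspaces).
\<close>

definition reducing_subspace :: "complex^'n^'n \<Rightarrow> (complex^'n) set \<Rightarrow> bool" where
  "reducing_subspace A S \<longleftrightarrow>
     vec.subspace S \<and> (\<forall>x\<in>S. A *v x \<in> S) \<and> (\<forall>x\<in>S. adj A *v x \<in> S)"

definition subspace_reducible :: "complex set \<Rightarrow> (complex \<Rightarrow> complex^'n^'n) \<Rightarrow> bool" where
  "subspace_reducible D F \<longleftrightarrow>
     (\<exists>S. {0} \<subset> S \<and> S \<subset> UNIV \<and> (\<forall>z\<in>D. reducing_subspace (F z) S))"

end

theory Submission
  imports Defs "HOL-Complex_Analysis.Conformal_Mappings"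
    "HOL-Computational_Algebra.Fundamental_Theorem_Algebra"
begin

text \<open>
  If the spectrum of the dilation \<open>F\<close> splits continuously into disjoint parts \<open>\<Lambda>1\<close>, \<open>\<Lambda>2\<close>, then the
  spectral projection \<open>P z\<close> of \<open>F z\<close> belonging to \<open>\<Lambda>1 z\<close> is holomorphic on a neighbourhood of the
  closed unit disk. On the unit circle \<open>F z\<close> is unitary, so \<open>P z\<close> is Hermitian there; hence
  \<open>P\<^sub>i\<^sub>j + P\<^sub>j\<^sub>i\<close> and \<open>\<i> (P\<^sub>i\<^sub>j - P\<^sub>j\<^sub>i)\<close> are real on the circle, and therefore constant by the maximum
  principle. The range of the constant Hermitian projection \<open>P\<close> is the reducing subspace.

  Holomorphy of \<open>P\<close> is obtained without contour integrals: let \<open>p\<close> and \<open>q\<close> be the monic polynomials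
  with roots \<open>\<Lambda>1 z\<close> and \<open>\<Lambda>2 z\<close>. Their coefficients are continuous in \<open>z\<close>, and holomorphic off the
  finite exceptional set by Lagrange interpolation, hence holomorphic; and \<open>P = q(F) (p(F) + q(F))\<^sup>-\<^sup>1\<close>.
\<close>

section \<open>Polynomials in a matrix\<close>

text \<open>Horner's scheme with the matrix product \<open>**\<close>, because \<open>*\<close> on
  this type is the entrywise product.\<close>

definition matrix_poly :: "complex poly \<Rightarrow> complex^'n^'n \<Rightarrow> complex^'n^'n" where
  "matrix_poly p A = fold_coeffs (\<lambda>a M. mat a + A ** M) p 0"

lemma mat_zero [simp]: "mat 0 = (0 :: 'a::semiring_1^'n^'n)"
  by (simp add: mat_def vec_eq_iff)

lemma matrix_add_rdistrib: "(A + B) ** C = A ** C + B ** (C :: 'a::semiring_1^'n^'m)"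
  by (simp add: matrix_matrix_mult_def vec_eq_iff sum.distrib distrib_right)

lemma matrix_vector_mult_axis: "A *v axis j 1 = (\<chi> i. A $ i $ j)"
  for A :: "'a::semiring_1^'n^'m"
  by (simp add: matrix_vector_mult_def vec_eq_iff axis_def mult_delta_right)

lemma matrix_vector_mult_sum: "(\<Sum>i\<in>I. M i) *v x = (\<Sum>i\<in>I. M i *v (x :: 'a::semiring_1^'n))"
  by (induction I rule: infinite_finite_induct) (simp_all add: matrix_vector_mult_add_rdistrib)

lemma mat_add: "mat (a + b) = mat a + (mat b :: 'a::semiring_1^'n^'n)"
  by (simp add: mat_def vec_eq_iff)

lemma mat_mult: "mat (a * b) = mat a ** (mat b :: 'a::semiring_1^'n^'n)"
  by (simp add: mat_def vec_eq_iff matrix_matrix_mult_def mult_delta_left mult_delta_right)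

lemma mat_commute: "mat a ** A = A ** mat (a :: 'a::comm_semiring_1)"
  by (simp add: mat_def vec_eq_iff matrix_matrix_mult_def mult_delta_left mult_delta_right
      mult.commute)

lemma mat_vector_mult: "mat a *v x = a *s (x :: 'a::semiring_1^'n)"
  by (simp add: mat_def vec_eq_iff matrix_vector_mult_def mult_delta_left)

lemma matrix_poly_0 [simp]: "matrix_poly 0 A = 0"
  by (simp add: matrix_poly_def)

lemma matrix_poly_pCons [simp]: "matrix_poly (pCons a p) A = mat a + A ** matrix_poly p A"
  by (cases "p = 0 \<and> a = 0") (auto simp: matrix_poly_def)

lemma matrix_poly_add: "matrix_poly (p + q) A = matrix_poly p A + matrix_poly q A"
  by (induction p q rule: poly_induct2) (auto simp: mat_add matrix_add_ldistrib algebra_simps)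

lemma matrix_poly_smult: "matrix_poly (smult c p) A = mat c ** matrix_poly p A"
proof (induction p)
  case (pCons a p)
  have "A ** (mat c ** matrix_poly p A) = mat c ** (A ** matrix_poly p A)"
    by (metis mat_commute matrix_mul_assoc)
  then show ?case
    by (simp add: pCons.IH mat_mult matrix_add_ldistrib)
qed simp

lemma matrix_poly_mult: "matrix_poly (p * q) A = matrix_poly p A ** matrix_poly q A"
  by (induction p)
     (simp_all add: matrix_poly_add matrix_poly_smult matrix_add_rdistrib matrix_mul_assoc)

lemma matrix_poly_sum: "matrix_poly (\<Sum>i\<in>I. p i) A = (\<Sum>i\<in>I. matrix_poly (p i) A)"
  by (induction I rule: infinite_finite_induct) (simp_all add: matrix_poly_add)

lemma matrix_poly_commute:
  assumes "X ** A = A ** X"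
  shows "X ** matrix_poly p A = matrix_poly p A ** X"
proof (induction p)
  case (pCons a p)
  have "X ** (A ** matrix_poly p A) = A ** matrix_poly p A ** X"
    by (metis assms matrix_mul_assoc pCons.IH)
  then show ?case
    by (simp add: matrix_add_ldistrib matrix_add_rdistrib mat_commute[of a X])
qed simp

lemma matrix_poly_eigenvector:
  assumes "A *v v = c *s v"
  shows "matrix_poly p A *v v = poly p c *s v"
proof (induction p)
  case (pCons a p)
  show ?case
    by (simp add: matrix_vector_mult_add_rdistrib mat_vector_mult pCons.IH
        flip: matrix_vector_mul_assoc)
       (simp add: assms vector_scalar_commute vec_eq_iff algebra_simps)
qed simp

section \<open>The Cayley--Hamilton theorem\<close>

lemma poly_det: "poly (det C) x = det (\<chi> i j. poly (C $ i $ j) (x :: complex))"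
  by (simp add: det_def poly_sum poly_prod)

lemma poly_charpoly: "poly (charpoly A) x = det (mat x - A)"
proof -
  have "(\<chi> i j. poly ((mat [:0, 1:] - (\<chi> i j. [:A $ i $ j:])) $ i $ j) x) = mat x - A"
    by (simp add: vec_eq_iff mat_def)
  then show ?thesis
    by (simp add: charpoly_def poly_det)
qed

text \<open>Cramer's rule is stated over a field, so the entries are compared after evaluation at
  each \<open>x\<close> off the roots of \<open>charpoly A\<close>. Multiplying by
  \<open>charpoly A\<close> extends the identity to the roots, and this nonzero factor then
  cancels.\<close>

lemma charpoly_adjugate:
  fixes A :: "complex^'n^'n"
  assumes "charpoly A \<noteq> 0"
  shows "\<exists>B. (mat [:0, 1:] - (\<chi> i j. [:A $ i $ j:])) ** B = mat (charpoly A)"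
proof
  define C :: "complex poly^'n^'n" where "C = mat [:0, 1:] - (\<chi> i j. [:A $ i $ j:])"
  \<comment> \<open>The adjugate: entry \<open>(k, j)\<close> is the numerator in Cramer's rule for
    the \<open>k\<close>-th unknown when the right-hand side is the \<open>j\<close>-th unit
    vector.\<close>
  define B :: "complex poly^'n^'n"
    where "B = (\<chi> k j. det (\<chi> i l. if l = k then mat 1 $ i $ j else C $ i $ l))"
  have "poly ((C ** B) $ i $ j) x = poly (mat (charpoly A) $ i $ j) x"
    if x: "poly (charpoly A) x \<noteq> 0" for i j x
  proof -
    define M where "M = mat x - A"
    have M: "poly (C $ i $ j) x = M $ i $ j" for i j
      by (simp add: C_def M_def mat_def)
    have det: "det M = poly (charpoly A) x"
      by (simp add: M_def poly_charpoly)
    define b :: "complex^'n" where "b = (\<chi> i. mat 1 $ i $ j)"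
    have B: "poly (B $ k $ j) x = det (\<chi> i l. if l = k then b $ i else M $ i $ l)" for k
      by (simp only: B_def vec_lambda_beta poly_det, intro arg_cong[where f = det])
         (simp add: vec_eq_iff M mat_def b_def)
    have "M *v (\<chi> k. poly (B $ k $ j) x / det M) = b"
      unfolding B by (subst cramer) (use x det in simp_all)
    then have "(M *v (\<chi> k. poly (B $ k $ j) x / det M)) $ i = b $ i"
      by simp
    then have "(\<Sum>k\<in>UNIV. M $ i $ k * poly (B $ k $ j) x) / det M = b $ i"
      by (simp add: matrix_vector_mult_def sum_divide_distrib)
    then have "(\<Sum>k\<in>UNIV. M $ i $ k * poly (B $ k $ j) x) = b $ i * det M"
      using x det by (simp add: field_simps)
    then show ?thesis
      by (simp add: matrix_matrix_mult_def poly_sum M b_def det mat_def)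
  qed
  then have "charpoly A * ((C ** B) $ i $ j - mat (charpoly A) $ i $ j) = 0" for i j
    by (subst poly_eq_poly_eq_iff[symmetric]) (auto simp: fun_eq_iff)
  then have "(C ** B) $ i $ j = mat (charpoly A) $ i $ j" for i j
    using assms by simp
  then show "(mat [:0, 1:] - (\<chi> i j. [:A $ i $ j:])) ** B = mat (charpoly A)"
    by (simp add: vec_eq_iff C_def)
qed

lemma matrix_vector_sum_axis:
  "(\<Sum>i\<in>UNIV. c i *s axis i 1) = (\<chi> i. c i)"
  for c :: "'n::finite \<Rightarrow> 'a::semiring_1"
  by (simp add: vec_eq_iff axis_def mult_delta_right)

text \<open>The entries of \<open>C\<close>, evaluated at \<open>A\<close>, annihilate the tuple of
  unit vectors. Applying the evaluated entries of the adjugate \<open>B\<close> and summing leaves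
  the evaluated characteristic polynomial acting on a single unit vector.\<close>

theorem Cayley_Hamilton:
  fixes A :: "complex^'n^'n"
  shows "matrix_poly (charpoly A) A = 0"
proof (cases "charpoly A = 0")
  case False
  define C where "C = mat [:0, 1:] - (\<chi> i j. [:A $ i $ j:])"
  obtain B where CB: "C ** B = mat (charpoly A)"
    using charpoly_adjugate[OF False] unfolding C_def by blast
  \<comment> \<open>The sum is \<open>A *v axis l 1\<close> minus its expansion in the unit vectors
    with coefficients \<open>A $ i $ l\<close>.\<close>
  have column: "(\<Sum>i\<in>UNIV. matrix_poly (C $ i $ l) A *v axis i 1) = 0" for l
  proof -
    have C: "matrix_poly (C $ i $ l) A = (if i = l then A else 0) - mat (A $ i $ l)" for i
    proof -
      have "C $ i $ l = [:- A $ i $ l:] + (if i = l then [:0, 1:] else 0)"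
        by (simp add: C_def mat_def)
      moreover have "mat (- A $ i $ l) = - (mat (A $ i $ l) :: complex^'n^'n)"
        by (simp add: mat_def vec_eq_iff)
      ultimately show ?thesis
        by (simp add: matrix_poly_add)
    qed
    have "(\<Sum>i\<in>UNIV. (if i = l then A else 0) *v axis i 1) = A *v axis l 1"
      by (simp add: if_distrib if_distribR cong: if_cong)
    then show ?thesis
      by (simp add: C matrix_vector_mult_diff_rdistrib sum_subtractf mat_vector_mult
          matrix_vector_sum_axis matrix_vector_mult_axis[of A])
  qed
  have "matrix_poly (charpoly A) A *v axis j 1 = 0" for j
  proof -
    have "matrix_poly (charpoly A) A *v axis j 1 =
        (\<Sum>i\<in>UNIV. matrix_poly ((C ** B) $ i $ j) A *v axis i 1)"
      by (simp add: CB mat_def if_distrib if_distribR cong: if_cong)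
    also have "\<dots> =
        (\<Sum>i\<in>UNIV. \<Sum>l\<in>UNIV. matrix_poly (B $ l $ j) A *v (matrix_poly (C $ i $ l) A *v axis i 1))"
    proof -
      have "(C ** B) $ i $ j = (\<Sum>l\<in>UNIV. B $ l $ j * C $ i $ l)" for i
        by (simp add: matrix_matrix_mult_def mult.commute)
      then show ?thesis
        by (simp only: matrix_poly_sum matrix_poly_mult matrix_vector_mult_sum
            matrix_vector_mul_assoc)
    qed
    also have "\<dots> =
        (\<Sum>l\<in>UNIV. matrix_poly (B $ l $ j) A *v (\<Sum>i\<in>UNIV. matrix_poly (C $ i $ l) A *v axis i 1))"
      by (subst sum.swap) (simp add: vec.linear_sum)
    also have "\<dots> = 0"
      by (simp add: column)
    finally show ?thesis .
  qed
  then show ?thesis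
    by (simp add: matrix_vector_mult_axis vec_eq_iff)
qed simp

section \<open>Eigenvalues and invertibility\<close>

lemma invertible_ker: "invertible A \<longleftrightarrow> (\<forall>x. A *v x = 0 \<longrightarrow> x = 0)"
  for A :: "'a::field^'n^'n"
  by (simp add: invertible_left_inverse matrix_left_invertible_ker)

lemma eigenvector_of_charpoly_root:
  assumes "poly (charpoly A) x = 0"
  obtains v where "v \<noteq> 0" "A *v v = x *s v"
proof -
  have "\<not> invertible (mat x - A)"
    using assms by (simp add: poly_charpoly invertible_det_nz)
  then obtain v where "v \<noteq> 0" "(mat x - A) *v v = 0"
    by (auto simp: invertible_ker)
  then show ?thesis
    using that[of v] by (simp add: matrix_vector_mult_diff_rdistrib mat_vector_mult)
qed

lemma eigenvalue_is_charpoly_root: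
  assumes "A *v v = x *s v" "v \<noteq> 0"
  shows "poly (charpoly A) x = 0"
proof -
  have "(mat x - A) *v v = 0"
    using assms by (simp add: matrix_vector_mult_diff_rdistrib mat_vector_mult)
  then have "\<not> invertible (mat x - A)"
    using assms by (auto simp: invertible_ker)
  then show ?thesis
    by (simp add: poly_charpoly invertible_det_nz)
qed

text \<open>Linear factors are split off one by one; each is injective at \<open>A\<close> because
  its root is not an eigenvalue of \<open>A\<close>.\<close>

lemma invertible_matrix_poly:
  assumes "p \<noteq> 0" "\<And>x. poly p x = 0 \<Longrightarrow> poly (charpoly A) x \<noteq> 0"
  shows "invertible (matrix_poly p A)"
  using assms
proof (induction "degree p" arbitrary: p rule: less_induct)
  case less
  show ?case
  proof (cases "degree p = 0")
    case True
    then obtain c where "p = [:c:]" "c \<noteq> 0"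
      using less.prems(1) by (metis degree_eq_zeroE pCons_0_0)
    then have "matrix_poly p A *v v = c *s v" for v
      by (simp add: mat_vector_mult)
    then show ?thesis
      using \<open>c \<noteq> 0\<close> by (simp add: invertible_ker)
  next
    case False
    then obtain x where x: "poly p x = 0"
      using alg_closed_imp_poly_has_root[of p] by auto
    then obtain q where p: "p = [:-x, 1:] * q"
      using poly_eq_0_iff_dvd by (metis dvdE)
    have q: "q \<noteq> 0"
      using less.prems(1) p by auto
    have "invertible (matrix_poly q A)"
    proof (rule less.hyps[OF _ q])
      show "degree q < degree p"
        unfolding p by (subst degree_mult_eq) (use q in auto)
    qed (use less.prems(2) p in auto)
    moreover have "invertible (matrix_poly [:-x, 1:] A)"
    proof -
      have "v = 0" if "matrix_poly [:-x, 1:] A *v v = 0" for v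
      proof (rule ccontr)
        assume "v \<noteq> 0"
        moreover have "A *v v = x *s v"
          using that by (simp add: matrix_vector_mult_add_rdistrib mat_vector_mult)
        ultimately show False
          using eigenvalue_is_charpoly_root less.prems(2) x by blast
      qed
      then show ?thesis
        by (simp add: invertible_ker)
    qed
    ultimately show ?thesis
      unfolding p matrix_poly_mult by (rule invertible_mult[rotated])
  qed
qed

section \<open>Matrices depending holomorphically on a parameter\<close>

lemma field_differentiable_eventually_eq:
  assumes "f field_differentiable at z" "\<forall>\<^sub>F w in nhds z. f w = g w"
  shows "g field_differentiable at z"
  using assms(1) DERIV_cong_ev[OF refl assms(2) refl] by (auto simp: field_differentiable_def)

text \<open>By Caratheodory's criterion \<open>f w = h w * (w - z)\<close> with \<open>h\<close>
  continuous at \<open>z\<close>, so the product has derivative \<open>h z * g z\<close>. This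
  admits a factor \<open>g\<close> that is so far known to be continuous but not
  differentiable.\<close>

lemma field_differentiable_mult_zero:
  fixes f g :: "complex \<Rightarrow> complex"
  assumes "f field_differentiable at z" "f z = 0" "isCont g z"
  shows "(\<lambda>w. f w * g w) field_differentiable at z"
proof -
  obtain h l where h: "\<And>w. f w - f z = h w * (w - z)" "isCont h z"
    using assms(1) unfolding field_differentiable_def CARAT_DERIV by blast
  have "f w = h w * (w - z)" for w
    using h(1)[of w] assms(2) by simp
  then have "((\<lambda>w. f w * g w) has_field_derivative h z * g z) (at z)"
    unfolding CARAT_DERIV
    using h(2) assms(3) by (intro exI[of _ "\<lambda>w. h w * g w"]) auto
  then show ?thesis
    by (auto simp: field_differentiable_def)
qed

lemma holomorphic_on_det:
  assumes "\<And>i j. (\<lambda>z. M z $ i $ j) holomorphic_on D"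
  shows "(\<lambda>z. det (M z)) holomorphic_on D"
  unfolding det_def by (intro holomorphic_intros assms)

lemma holomorphic_on_poly_charpoly:
  assumes "\<And>i j. (\<lambda>z. F z $ i $ j) holomorphic_on D"
  shows "(\<lambda>z. poly (charpoly (F z)) x) holomorphic_on D"
  unfolding poly_charpoly
  by (intro holomorphic_on_det) (auto intro!: holomorphic_intros assms)

lemma invertible_matrix_inv:
  assumes "invertible A"
  shows "A ** matrix_inv A = mat 1" "matrix_inv A ** A = mat 1"
  using assms unfolding invertible_def matrix_inv_def by (metis (mono_tags, lifting) someI)+

text \<open>Cramer's rule for the \<open>j\<close>-th column of the inverse. Written as quotients of
  determinants, the entries of an inverse are visibly holomorphic.\<close>

lemma matrix_inv_entry:
  fixes A :: "'a::field^'n^'n"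
  assumes "invertible A"
  shows "matrix_inv A $ k $ j = det (\<chi> i l. if l = k then axis j 1 $ i else A $ i $ l) / det A"
proof -
  have "A *v (matrix_inv A *v axis j 1) = axis j 1"
    by (simp add: matrix_vector_mul_assoc invertible_matrix_inv(1)[OF assms])
  then have "matrix_inv A *v axis j 1 =
      (\<chi> k. det (\<chi> i l. if l = k then axis j 1 $ i else A $ i $ l) / det A)"
    using assms by (subst (asm) cramer) (simp_all add: invertible_det_nz)
  then show ?thesis
    by (simp add: matrix_vector_mult_axis[of "matrix_inv A"] vec_eq_iff)
qed

lemma matrix_inv_commute:
  assumes "invertible A" "X ** A = A ** X"
  shows "X ** matrix_inv A = matrix_inv A ** X"
proof -
  have "X ** matrix_inv A = matrix_inv A ** (A ** X) ** matrix_inv A"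
    by (simp add: matrix_mul_assoc invertible_matrix_inv(2)[OF assms(1)])
  also have "\<dots> = matrix_inv A ** X ** (A ** matrix_inv A)"
    by (simp add: assms(2)[symmetric] matrix_mul_assoc)
  finally show ?thesis
    by (simp add: invertible_matrix_inv(1)[OF assms(1)])
qed

lemma holomorphic_on_matrix_mult:
  assumes "\<And>i j. (\<lambda>z. A z $ i $ j) holomorphic_on D" "\<And>i j. (\<lambda>z. B z $ i $ j) holomorphic_on D"
  shows "(\<lambda>z. (A z ** B z) $ i $ j) holomorphic_on D"
  unfolding matrix_matrix_mult_def using assms by (auto intro!: holomorphic_intros)

lemma holomorphic_on_matrix_inv:
  fixes A :: "complex \<Rightarrow> complex^'n^'n"
  assumes "\<And>i j. (\<lambda>z. A z $ i $ j) holomorphic_on D" "\<And>z. z \<in> D \<Longrightarrow> invertible (A z)"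
  shows "(\<lambda>z. matrix_inv (A z) $ i $ j) holomorphic_on D"
proof -
  have "(\<lambda>z. det (\<chi> k l. if l = i then axis j 1 $ k else A z $ k $ l) / det (A z)) holomorphic_on D"
  proof (intro holomorphic_on_divide holomorphic_on_det)
    show "(\<lambda>z. (\<chi> k l. if l = i then axis j 1 $ k else A z $ k $ l) $ k $ l) holomorphic_on D" for k l
      using assms(1) by (cases "l = i") (simp_all add: holomorphic_on_const)
  qed (use assms in \<open>simp_all add: invertible_det_nz\<close>)
  then show ?thesis
    by (rule holomorphic_transform) (simp add: matrix_inv_entry assms(2))
qed

text \<open>The bound \<open>m\<close>, uniform in \<open>z\<close>, limits the length of Horner's
  scheme, and the induction runs on it.\<close>

lemma holomorphic_on_matrix_poly:
  assumes "\<And>j. (\<lambda>z. coeff (r z) j) holomorphic_on D" "\<And>z. z \<in> D \<Longrightarrow> degree (r z) \<le> m"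
    and F: "\<And>i j. (\<lambda>z. F z $ i $ j) holomorphic_on D"
  shows "(\<lambda>z. matrix_poly (r z) (F z) $ i $ j) holomorphic_on D"
  using assms(1,2)
proof (induction m arbitrary: r i j)
  case 0
  have "(\<lambda>z. if i = j then coeff (r z) 0 else 0) holomorphic_on D"
    using 0 by (cases "i = j") (simp_all add: holomorphic_on_const)
  moreover have "matrix_poly (r z) (F z) = mat (coeff (r z) 0)" if "z \<in> D" for z
  proof -
    have "r z = [:coeff (r z) 0:]"
      using 0(2)[OF that] degree_eq_zeroE[of "r z"] by (metis coeff_pCons_0 le_zero_eq)
    then show ?thesis
      by (metis add.right_neutral matrix_poly_0 matrix_poly_pCons mat_zero mat_commute times0_right)
  qed
  ultimately show ?case
    by (elim holomorphic_transform) (simp add: mat_def)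
next
  case (Suc m)
  \<comment> \<open>\<open>poly_shift 1\<close> drops the constant coefficient and lowers the other
    exponents by one.\<close>
  let ?s = "\<lambda>z. poly_shift 1 (r z)"
  have "(\<lambda>z. matrix_poly (?s z) (F z) $ i $ j) holomorphic_on D" for i j
  proof (rule Suc.IH)
    show "degree (?s z) \<le> m" if "z \<in> D" for z
      using Suc.prems(2)[OF that] by (intro degree_le) (auto simp: coeff_poly_shift coeff_eq_0)
  qed (simp add: coeff_poly_shift Suc.prems(1))
  then have "(\<lambda>z. (F z ** matrix_poly (?s z) (F z)) $ i $ j) holomorphic_on D"
    by (intro holomorphic_on_matrix_mult F)
  moreover have "(\<lambda>z. if i = j then coeff (r z) 0 else 0) holomorphic_on D"
    using Suc.prems(1) by (cases "i = j") (simp_all add: holomorphic_on_const)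
  ultimately have "(\<lambda>z. (if i = j then coeff (r z) 0 else 0) + (F z ** matrix_poly (?s z) (F z)) $ i $ j)
      holomorphic_on D"
    by (intro holomorphic_intros)
  moreover have "matrix_poly (r z) (F z) = mat (coeff (r z) 0) + F z ** matrix_poly (?s z) (F z)" for z
  proof -
    have "r z = pCons (coeff (r z) 0) (?s z)"
      by (simp add: poly_eq_iff coeff_pCons coeff_poly_shift split: nat.split)
    then show ?thesis
      by (metis matrix_poly_pCons)
  qed
  ultimately show ?case
    by (elim holomorphic_transform) (simp add: mat_def)
qed

section \<open>Monic polynomials with prescribed roots\<close>

definition root_poly :: "complex multiset \<Rightarrow> complex poly" where
  "root_poly M = (\<Prod>x\<in>#M. [:-x, 1:])"

lemma root_poly_add: "root_poly (M + N) = root_poly M * root_poly N"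
  by (simp add: root_poly_def)

lemma root_poly_nonzero [simp]: "root_poly M \<noteq> 0"
  by (auto simp: root_poly_def prod_mset_zero_iff)

lemma lead_coeff_root_poly [simp]: "lead_coeff (root_poly M) = 1"
  by (induction M) (simp_all add: root_poly_def lead_coeff_mult del: mult_pCons_left)

lemma degree_root_poly [simp]: "degree (root_poly M) = size M"
proof (induction M)
  case (add x M)
  have "degree ([:-x, 1:] * root_poly M) = 1 + size M"
    by (subst degree_mult_eq) (simp_all add: add.IH)
  then show ?case
    by (simp add: root_poly_def)
qed (simp add: root_poly_def)

lemma poly_root_poly_eq_0_iff: "poly (root_poly M) x = 0 \<longleftrightarrow> x \<in># M"
  by (induction M) (auto simp: root_poly_def)

lemma charpoly_root_poly:
  "charpoly A = smult (lead_coeff (charpoly A)) (root_poly (eigenvalues A))"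
  by (simp add: root_poly_def eigenvalues_def complex_poly_decompose_multiset)

text \<open>Induction on the roots: multiplying by \<open>[:-x, 1:]\<close> turns coefficients
  \<open>c_j\<close> into \<open>c_(j-1) - x * c_j\<close>, which is continuous in \<open>x\<close>
  and the old coefficients.\<close>

lemma coeff_root_poly_continuous:
  assumes "e > 0"
  shows "\<exists>d>0. \<forall>N. rel_mset (\<lambda>x y. dist x y < d) M N \<longrightarrow>
           (\<forall>j. dist (coeff (root_poly M) j) (coeff (root_poly N) j) < e)"
  using assms
proof (induction M arbitrary: e)
  case empty
  then show ?case
    by (auto intro!: exI[of _ 1])
next
  case (add x M)
  define f where "f = coeff (root_poly M)"
  define C where "C = (\<Sum>j\<le>size M. norm (f j))"
  have C: "C \<ge> 0" "norm (f j) \<le> C" for j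
  proof -
    show "C \<ge> 0"
      by (simp add: C_def sum_nonneg)
    show "norm (f j) \<le> C"
    proof (cases "j \<le> size M")
      case True
      then show ?thesis
        unfolding C_def by (intro member_le_sum) auto
    next
      case False
      then have "f j = 0"
        by (simp add: f_def coeff_eq_0)
      then show ?thesis
        using \<open>C \<ge> 0\<close> by simp
    qed
  qed
  \<comment> \<open>The bound 1 keeps the perturbed coefficients at most \<open>C + 1\<close> in
    norm; the other bound allots \<open>e / 3\<close> to the terms containing
    \<open>f - g\<close>.\<close>
  define e' where "e' = min 1 (e / (3 * (1 + norm x)))"
  have e': "e' > 0" "e' \<le> 1" "e' * (1 + norm x) \<le> e / 3"
    using add.prems norm_ge_zero[of x]
    by (auto simp: e'_def min_def field_simps add_pos_nonneg intro: add_pos_nonneg)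
  obtain d' where d': "d' > 0" "\<And>N j. rel_mset (\<lambda>x y. dist x y < d') M N \<Longrightarrow>
      dist (f j) (coeff (root_poly N) j) < e'"
    unfolding f_def using add.IH[OF e'(1)] by blast
  \<comment> \<open>Moving the new root from \<open>x\<close> to \<open>y\<close> costs at most
    \<open>d * (C + 1)\<close>, which is again kept within \<open>e / 3\<close>.\<close>
  define d where "d = min d' (e / 3 / (C + 1))"
  have C1: "C + 1 > 0"
    using C(1) by linarith
  have d: "d > 0" "d \<le> d'" "d * (C + 1) \<le> e / 3"
  proof -
    show "d > 0" "d \<le> d'"
      using d'(1) add.prems C1 by (simp_all add: d_def)
    have "d * (C + 1) \<le> e / 3 / (C + 1) * (C + 1)"
      using C1 by (intro mult_right_mono) (simp_all add: d_def)
    also have "\<dots> = e / 3"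
      using C1 by (intro nonzero_eq_divide_eq[THEN iffD1]) simp_all
    finally show "d * (C + 1) \<le> e / 3" .
  qed
  show ?case
  proof (intro exI[of _ d] conjI allI impI)
    fix N j assume "rel_mset (\<lambda>x y. dist x y < d) (add_mset x M) N"
    from msed_rel_invL[OF this] obtain y N' where N: "N = add_mset y N'" and xy: "dist x y < d"
      and rel: "rel_mset (\<lambda>x y. dist x y < d) M N'"
      by blast
    define g where "g = coeff (root_poly N')"
    have fg: "dist (f j) (g j) < e'" for j
      unfolding g_def
      by (rule d'(2)) (rule multiset.rel_mono_strong[OF rel], use d in auto)
    have coeff: "coeff (root_poly (add_mset u K)) j =
        (if j = 0 then 0 else coeff (root_poly K) (j - 1)) - u * coeff (root_poly K) j" for u K
      by (cases j) (auto simp: root_poly_def)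
    have 1: "norm ((if j = 0 then 0 else f (j - 1)) - (if j = 0 then 0 else g (j - 1))) \<le> e'"
      using fg[of "j - 1"] e' by (auto simp: dist_norm)
    have 2: "norm (y - x) * norm (g j) \<le> d * (C + 1)"
    proof (rule mult_mono)
      show "norm (g j) \<le> C + 1"
        using fg[of j] C(2)[of j] e' norm_triangle_ineq2[of "g j" "f j"]
        by (simp add: dist_norm norm_minus_commute)
    qed (use xy d in \<open>auto simp: dist_norm norm_minus_commute\<close>)
    have 3: "norm x * norm (g j - f j) \<le> norm x * e'"
      using fg[of j] by (intro mult_left_mono) (auto simp: dist_norm norm_minus_commute)
    have "coeff (root_poly (add_mset x M)) j - coeff (root_poly N) j =
        ((if j = 0 then 0 else f (j - 1)) - (if j = 0 then 0 else g (j - 1)))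
        + ((y - x) * g j + x * (g j - f j))"
      unfolding N coeff f_def g_def by (simp add: algebra_simps)
    also have "norm \<dots> \<le> e' + (d * (C + 1) + norm x * e')"
      by (intro norm_triangle_mono 1) (use 2 3 in \<open>simp_all add: norm_mult\<close>)
    also have "\<dots> = e' * (1 + norm x) + d * (C + 1)"
      by (simp add: algebra_simps)
    also have "\<dots> < e"
      using e'(3) d(3) add.prems by simp
    finally show "dist (coeff (root_poly (add_mset x M)) j) (coeff (root_poly N) j) < e"
      by (simp add: dist_norm)
  qed fact
qed

lemma continuous_on_coeff_root_poly:
  assumes "continuous_multivalued D k \<Lambda>"
  shows "continuous_on D (\<lambda>z. coeff (root_poly (\<Lambda> z)) j)"
  unfolding continuous_on_iff
proof (intro ballI allI impI)
  fix z and e :: real assume z: "z \<in> D" and e: "e > 0"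
  obtain d where d: "d > 0" "\<And>N j. rel_mset (\<lambda>x y. dist x y < d) (\<Lambda> z) N \<Longrightarrow>
      dist (coeff (root_poly (\<Lambda> z)) j) (coeff (root_poly N) j) < e"
    using coeff_root_poly_continuous[OF e] by meson
  obtain r where "r > 0" "\<And>w. w \<in> D \<Longrightarrow> dist z w < r \<Longrightarrow> rel_mset (\<lambda>x y. dist x y < d) (\<Lambda> z) (\<Lambda> w)"
    using assms z d(1) unfolding continuous_multivalued_def by meson
  then show "\<exists>r>0. \<forall>w\<in>D. dist w z < r \<longrightarrow>
      dist (coeff (root_poly (\<Lambda> w)) j) (coeff (root_poly (\<Lambda> z)) j) < e"
    using d(2) by (metis dist_commute)
qed

lemma continuous_on_poly_root_poly:
  assumes "continuous_multivalued D k \<Lambda>"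
  shows "continuous_on D (\<lambda>z. poly (root_poly (\<Lambda> z)) x)"
proof -
  have "continuous_on D (\<lambda>z. \<Sum>j\<le>k. coeff (root_poly (\<Lambda> z)) j * x ^ j)"
    by (intro continuous_intros continuous_on_coeff_root_poly[OF assms])
  moreover have "poly (root_poly (\<Lambda> z)) x = (\<Sum>j\<le>k. coeff (root_poly (\<Lambda> z)) j * x ^ j)"
    if "z \<in> D" for z
    using that assms by (simp add: poly_altdef continuous_multivalued_def)
  ultimately show ?thesis
    by (simp cong: continuous_on_cong)
qed

text \<open>The weights \<open>c\<close> depend on the nodes alone, so differentiability passes from
  the values of a varying polynomial at fixed nodes to its coefficients.\<close>

lemma Lagrange_interpolation_coeff:
  fixes A :: "'a::field set"
  assumes "finite A"
  obtains c where "\<And>p j. degree p < card A \<Longrightarrow> coeff p j = (\<Sum>x\<in>A. poly p x * c x j)"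
proof
  \<comment> \<open>The Lagrange basis: \<open>L x\<close> is 1 at \<open>x\<close> and 0 at the
    other nodes. Its coefficients are the weights.\<close>
  define L where "L x = smult (inverse (\<Prod>y\<in>A - {x}. x - y)) (\<Prod>y\<in>A - {x}. [:-y, 1:])" for x
  fix p :: "'a poly" and j assume p: "degree p < card A"
  have deg: "degree (L x) \<le> card A - 1" if "x \<in> A" for x
    unfolding L_def using assms that
    by (intro order.trans[OF degree_smult_le] order.trans[OF degree_prod_sum_le]) auto
  have "p = (\<Sum>x\<in>A. smult (poly p x) (L x))"
  proof (rule poly_eqI_degree[of A])
    fix y assume y: "y \<in> A"
    have "poly (L x) y = (if x = y then 1 else 0)" if "x \<in> A" for x
      using assms y that by (auto simp: L_def poly_prod)
    then have "(\<Sum>x\<in>A. poly p x * poly (L x) y) = (\<Sum>x\<in>A. if x = y then poly p x else 0)"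
      by (intro sum.cong) simp_all
    then show "poly p y = poly (\<Sum>x\<in>A. smult (poly p x) (L x)) y"
      using assms y by (simp add: poly_sum)
  next
    have "degree (\<Sum>x\<in>A. smult (poly p x) (L x)) \<le> card A - 1"
      using assms deg by (intro degree_sum_le order.trans[OF degree_smult_le]) auto
    then show "degree (\<Sum>x\<in>A. smult (poly p x) (L x)) < card A"
      using p by linarith
  qed (use p in auto)
  then have "coeff p j = coeff (\<Sum>x\<in>A. smult (poly p x) (L x)) j"
    by simp
  then show "coeff p j = (\<Sum>x\<in>A. poly p x * coeff (L x) j)"
    by (simp add: coeff_sum)
qed

section \<open>Splitting the spectrum\<close>

text \<open>A witness against entanglement, for a holomorphic \<open>F\<close> on an open set.
  Unitarity on the circle enters later, in \<open>P_hermitian\<close>.\<close>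

locale eigenvalue_partition =
  fixes D :: "complex set" and F :: "complex \<Rightarrow> complex^'n^'n" and k :: nat
    and \<Lambda>1 \<Lambda>2 :: "complex \<Rightarrow> complex multiset"
  assumes open_domain: "open D"
    and holomorphic: "\<And>i j. (\<lambda>z. F z $ i $ j) holomorphic_on D"
    and fractured: "fractured D F"
    and k: "1 \<le> k" "k \<le> CARD('n) - 1"
    and continuous: "continuous_multivalued D k \<Lambda>1" "continuous_multivalued D (CARD('n) - k) \<Lambda>2"
    and union: "\<And>z. z \<in> D \<Longrightarrow> eigenvalues (F z) = \<Lambda>1 z + \<Lambda>2 z"
    and disjoint: "\<And>z. z \<in> D \<Longrightarrow> \<Lambda>1 z \<inter># \<Lambda>2 z = {#}"
begin

definition p where "p z = root_poly (\<Lambda>1 z)"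
definition q where "q z = root_poly (\<Lambda>2 z)"

lemma size1: "z \<in> D \<Longrightarrow> size (\<Lambda>1 z) = k" and size2: "z \<in> D \<Longrightarrow> size (\<Lambda>2 z) = CARD('n) - k"
  using continuous by (auto simp: continuous_multivalued_def)

text \<open>By this symmetry, facts about \<open>p\<close> and \<open>G\<close> transfer to
  \<open>q\<close> and \<open>H\<close>.\<close>

lemma swap: "eigenvalue_partition D F (CARD('n) - k) \<Lambda>2 \<Lambda>1"
  using open_domain holomorphic fractured k continuous union disjoint
  by unfold_locales (auto simp: add.commute inter_mset_def[symmetric] multiset_inter_commute)

text \<open>\<open>proots 0\<close> is the empty multiset, whereas \<Lambda>1 has at least one
  element at \<open>z\<close>.\<close>

lemma charpoly_nonzero: "z \<in> D \<Longrightarrow> charpoly (F z) \<noteq> 0"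
  using union[of z] size1[of z] k by (auto simp: eigenvalues_def)

lemma charpoly_eq: "z \<in> D \<Longrightarrow> charpoly (F z) = smult (lead_coeff (charpoly (F z))) (p z * q z)"
  using charpoly_root_poly[of "F z"] by (simp add: p_def q_def union root_poly_add)

lemma p_q_no_common_root: "z \<in> D \<Longrightarrow> poly (p z) x = 0 \<Longrightarrow> poly (q z) x \<noteq> 0"
  using disjoint[of z] by (auto simp: p_def q_def poly_root_poly_eq_0_iff disjunct_not_in)

lemma isCont_p: "z \<in> D \<Longrightarrow> isCont (\<lambda>w. poly (p w) x) z"
  and isCont_q: "z \<in> D \<Longrightarrow> isCont (\<lambda>w. poly (q w) x) z"
  unfolding p_def q_def
  using continuous_on_poly_root_poly[OF continuous(1)] continuous_on_poly_root_poly[OF continuous(2)]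
    open_domain by (auto simp: continuous_on_eq_continuous_at)

text \<open>
  Where the eigenvalues are simple, \<open>p w - p z\<close> is determined by its values \<open>p w x\<close> at the roots \<open>x\<close>
  of \<open>p z\<close>, and \<open>p w x\<close> is \<open>det (x - F w)\<close>, holomorphic and zero at \<open>w = z\<close>, times a continuous factor.
\<close>

lemma poly_p_differentiable:
  assumes z: "z \<in> D" and x: "poly (p z) x = 0"
  shows "(\<lambda>w. poly (p w) x) field_differentiable at z"
proof -
  let ?\<chi> = "\<lambda>w y. poly (charpoly (F w)) y"
  obtain y where y: "?\<chi> z y \<noteq> 0"
    using charpoly_nonzero[OF z] poly_all_0_iff_0 by blast
  have \<chi>: "(\<lambda>w. ?\<chi> w u) field_differentiable at z" for u
    using holomorphic_on_poly_charpoly[OF holomorphic] z open_domain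
    by (metis holomorphic_on_imp_differentiable_at)
  note cont = isCont_p[OF z] isCont_q[OF z] field_differentiable_imp_continuous_at[OF \<chi>]
  have qx: "poly (q z) x \<noteq> 0"
    using p_q_no_common_root z x by blast
  \<comment> \<open>\<open>charpoly (F w)\<close> is a scalar multiple of \<open>p w * q w\<close>;
    comparing its values at \<open>x\<close> and at the auxiliary point \<open>y\<close> eliminates
    the scalar.\<close>
  let ?h = "\<lambda>w. ?\<chi> w x * (poly (p w) y * poly (q w) y / (?\<chi> w y * poly (q w) x))"
  have "?\<chi> z x = 0"
    by (subst charpoly_eq[OF z]) (simp add: x)
  then have "?h field_differentiable at z"
    by (intro field_differentiable_mult_zero \<chi>) (auto intro!: continuous_intros cont simp: y qx)
  moreover have "\<forall>\<^sub>F w in nhds z. ?h w = poly (p w) x"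
  proof -
    have "\<forall>\<^sub>F w in nhds z. w \<in> D"
      using z open_domain by (simp add: eventually_nhds_in_open)
    moreover have "\<forall>\<^sub>F w in nhds z. g w \<noteq> 0" if "isCont g z" "g z \<noteq> 0" for g :: "complex \<Rightarrow> complex"
      using that unfolding isCont_def tendsto_at_iff_tendsto_nhds by (rule tendsto_imp_eventually_ne)
    from this[OF cont(3) y] this[OF cont(2) qx]
    have "\<forall>\<^sub>F w in nhds z. ?\<chi> w y \<noteq> 0" "\<forall>\<^sub>F w in nhds z. poly (q w) x \<noteq> 0" .
    ultimately show ?thesis
    proof eventually_elim
      case (elim w)
      have *: "?\<chi> w u = lead_coeff (charpoly (F w)) * (poly (p w) u * poly (q w) u)" for u
        by (subst charpoly_eq) (use elim in auto)
      show ?case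
        using elim unfolding * by (simp add: field_simps)
    qed
  qed
  ultimately show ?thesis
    by (rule field_differentiable_eventually_eq)
qed

text \<open>The coefficients are continuous on all of \<open>D\<close>, so the finitely many
  exceptional points are removable singularities. Near any other \<open>z\<close>, interpolation at
  the roots of \<open>p z\<close>, kept fixed, applies.\<close>

lemma coeff_p_holomorphic: "(\<lambda>z. coeff (p z) j) holomorphic_on D"
proof (rule no_isolated_singularity)
  let ?K = "exceptional_set D F"
  show "finite ?K"
    using fractured by (simp add: fractured_def)
  have "open (D - ?K)"
    using open_domain \<open>finite ?K\<close> by (simp add: finite_imp_closed open_Diff)
  moreover have "(\<lambda>z. coeff (p z) j) field_differentiable at z" if "z \<in> D - ?K" for z
  proof -
    have z: "z \<in> D" and "\<And>x. \<not> order x (charpoly (F z)) \<ge> 2"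
      using that by (auto simp: exceptional_set_def has_repeated_eigenvalue_def)
    then have simple: "order x (charpoly (F z)) \<le> 1" for x
      by (simp add: not_le less_Suc_eq_le numeral_2_eq_2)
    have "count (\<Lambda>1 z) x \<le> 1" for x
    proof -
      have "count (\<Lambda>1 z) x \<le> count (eigenvalues (F z)) x"
        by (simp add: union z)
      also have "\<dots> = order x (charpoly (F z))"
        by (simp add: eigenvalues_def charpoly_nonzero z)
      finally show ?thesis
        using simple[of x] by simp
    qed
    \<comment> \<open>Since no eigenvalue is repeated at \<open>z\<close>, \<Lambda>1 consists there
      of \<open>k\<close> distinct points, enough nodes for degree below \<open>k\<close>.\<close>
    then have "mset_set (set_mset (\<Lambda>1 z)) = \<Lambda>1 z"
      by (intro multiset_eqI) (metis One_nat_def count_eq_zero_iff count_mset_set'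
          finite_set_mset le_Suc_eq le_zero_eq)
    then have card: "card (set_mset (\<Lambda>1 z)) = k"
      using size1[OF z] by (metis size_mset_set)
    obtain c where c: "\<And>r j. degree r < card (set_mset (\<Lambda>1 z)) \<Longrightarrow>
        coeff r j = (\<Sum>x\<in>set_mset (\<Lambda>1 z). poly r x * c x j)"
      using Lagrange_interpolation_coeff[of "set_mset (\<Lambda>1 z)"] by auto
    have root: "poly (p z) x = 0" if "x \<in># \<Lambda>1 z" for x
      using that by (simp add: p_def poly_root_poly_eq_0_iff)
    let ?h = "\<lambda>w. coeff (p z) j + (\<Sum>x\<in>set_mset (\<Lambda>1 z). poly (p w) x * c x j)"
    have "?h field_differentiable at z"
      by (auto simp: root intro!: derivative_intros poly_p_differentiable z)
    moreover have "\<forall>\<^sub>F w in nhds z. ?h w = coeff (p w) j"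
    proof -
      have "\<forall>\<^sub>F w in nhds z. w \<in> D"
        using z open_domain by (simp add: eventually_nhds_in_open)
      then show ?thesis
      proof eventually_elim
        case (elim w)
        \<comment> \<open>Both polynomials are monic of degree \<open>k\<close>, so the leading
          terms cancel.\<close>
        have "degree (p w - p z) < card (set_mset (\<Lambda>1 z))"
        proof (rule degree_lessI)
          have "coeff (p u) k = 1" "degree (p u) = k" if "u \<in> D" for u
            using lead_coeff_root_poly[of "\<Lambda>1 u"] size1[OF that] by (auto simp: p_def)
          then show "\<forall>i\<ge>card (set_mset (\<Lambda>1 z)). coeff (p w - p z) i = 0"
            using elim z by (metis card coeff_0 coeff_diff coeff_eq_0 diff_self le_neq_implies_less)
        qed (use k card in auto)
        then have "coeff (p w - p z) j = (\<Sum>x\<in>set_mset (\<Lambda>1 z). poly (p w - p z) x * c x j)"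
          by (rule c)
        then show ?case
          by (simp add: root algebra_simps)
      qed
    qed
    ultimately show ?thesis
      by (rule field_differentiable_eventually_eq)
  qed
  ultimately show "(\<lambda>z. coeff (p z) j) holomorphic_on (D - ?K)"
    by (simp add: holomorphic_on_def field_differentiable_at_within)
qed (use continuous_on_coeff_root_poly[OF continuous(1)] open_domain in \<open>auto simp: p_def\<close>)

end

section \<open>The spectral projection\<close>

context eigenvalue_partition
begin

definition "G z = matrix_poly (q z) (F z)"
definition "H z = matrix_poly (p z) (F z)"

text \<open>
  \<open>G\<close> vanishes on the generalized eigenspaces of \<open>\<Lambda>2\<close> and \<open>H\<close> on those of \<open>\<Lambda>1\<close>, so \<open>P\<close> is the
  Riesz projection onto the latter.
\<close>

definition "P z = G z ** matrix_inv (G z + H z)"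

lemma degree_p: "z \<in> D \<Longrightarrow> degree (p z) = k" and degree_q: "z \<in> D \<Longrightarrow> degree (q z) = CARD('n) - k"
  by (simp_all add: p_def q_def size1 size2)

lemma coeff_q_holomorphic: "(\<lambda>z. coeff (q z) j) holomorphic_on D"
  using eigenvalue_partition.coeff_p_holomorphic[OF swap]
  by (simp add: q_def eigenvalue_partition.p_def[OF swap])

lemma G_holomorphic: "(\<lambda>z. G z $ i $ j) holomorphic_on D"
  unfolding G_def
  by (rule holomorphic_on_matrix_poly[where m = "CARD('n) - k"])
     (simp_all add: coeff_q_holomorphic degree_q holomorphic)

lemma H_holomorphic: "(\<lambda>z. H z $ i $ j) holomorphic_on D"
  unfolding H_def
  by (rule holomorphic_on_matrix_poly[where m = k])
     (simp_all add: coeff_p_holomorphic degree_p holomorphic)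

lemma root_of_p:
  assumes "z \<in> D"
  obtains x where "poly (p z) x = 0"
proof -
  have "\<Lambda>1 z \<noteq> {#}"
    using size1[OF assms] k by auto
  then show ?thesis
    using that unfolding p_def poly_root_poly_eq_0_iff by blast
qed

text \<open>Each eigenvalue is a root of exactly one of \<open>p z\<close> and \<open>q z\<close>,
  so their sum does not vanish there.\<close>

lemma invertible_GH:
  assumes z: "z \<in> D"
  shows "invertible (G z + H z)"
proof -
  obtain x where "poly (p z) x = 0"
    using root_of_p[OF z] .
  then have "poly (q z + p z) x \<noteq> 0"
    using p_q_no_common_root[OF z] by auto
  then have "q z + p z \<noteq> 0"
    by (metis poly_0)
  moreover have "poly (charpoly (F z)) x \<noteq> 0" if "poly (q z + p z) x = 0" for x
  proof
    assume "poly (charpoly (F z)) x = 0"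
    then have "poly (p z) x = 0 \<or> poly (q z) x = 0"
      using charpoly_nonzero[OF z] by (subst (asm) charpoly_eq[OF z]) auto
    with that p_q_no_common_root[OF z, of x] show False
      by auto
  qed
  ultimately have "invertible (matrix_poly (q z + p z) (F z))"
    by (rule invertible_matrix_poly)
  then show ?thesis
    by (simp add: matrix_poly_add G_def H_def)
qed

lemma P_holomorphic: "(\<lambda>z. P z $ i $ j) holomorphic_on D"
  unfolding P_def
  by (intro holomorphic_on_matrix_mult G_holomorphic holomorphic_on_matrix_inv)
     (auto intro!: holomorphic_intros G_holomorphic H_holomorphic invertible_GH)

text \<open>Stated for arbitrary \<open>X\<close> because it is applied to \<open>F z\<close>, to
  \<open>H z\<close>, and on the circle to the adjoints of \<open>F z\<close> and
  \<open>P z\<close>.\<close>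

lemma P_commute:
  assumes z: "z \<in> D" and X: "X ** F z = F z ** X"
  shows "X ** P z = P z ** X"
proof -
  have G: "X ** G z = G z ** X" and H: "X ** H z = H z ** X"
    unfolding G_def H_def by (rule matrix_poly_commute[OF X])+
  then have "X ** (G z + H z) = (G z + H z) ** X"
    by (simp add: matrix_add_ldistrib matrix_add_rdistrib)
  from matrix_inv_commute[OF invertible_GH[OF z] this] show ?thesis
    unfolding P_def by (metis G matrix_mul_assoc)
qed

text \<open>Cayley-Hamilton, after division by the leading coefficient of the characteristic
  polynomial.\<close>

lemma G_H: "z \<in> D \<Longrightarrow> G z ** H z = 0"
proof -
  assume z: "z \<in> D"
  let ?c = "lead_coeff (charpoly (F z))"
  have "mat ?c ** (G z ** H z) = matrix_poly (charpoly (F z)) (F z)"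
    by (subst (2) charpoly_eq[OF z])
       (simp add: matrix_poly_smult matrix_poly_mult[symmetric] G_def H_def mult.commute)
  then have "mat (1 / ?c) ** (mat ?c ** (G z ** H z)) = 0"
    by (simp add: Cayley_Hamilton)
  then show ?thesis
    using charpoly_nonzero[OF z] by (simp add: matrix_mul_assoc mat_mult[symmetric])
qed

lemma P_H: 
  assumes "z \<in> D"
  shows "P z ** H z = 0"
proof -
  have "H z ** F z = F z ** H z"
    unfolding H_def by (rule matrix_poly_commute[symmetric]) simp
  then have "P z ** H z = H z ** P z"
    using P_commute[OF assms] by metis
  also have "H z ** G z = G z ** H z"
    unfolding G_def by (rule matrix_poly_commute) fact
  then have "H z ** P z = 0"
    by (simp add: P_def matrix_mul_assoc G_H[OF assms])
  finally show ?thesis .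
qed

text \<open>As \<open>P z\<close> kills \<open>H z\<close>, it has the same product with
  \<open>G z + H z\<close> as with \<open>G z\<close>; multiplying by the inverse of the sum gives
  the claim.\<close>

lemma P_idempotent:
  assumes "z \<in> D"
  shows "P z ** P z = P z"
proof -
  have "P z ** (G z + H z) = P z ** G z"
    by (simp add: matrix_add_ldistrib P_H[OF assms])
  then have "P z ** G z ** matrix_inv (G z + H z) = P z"
    by (metis assms invertible_GH invertible_matrix_inv(1) matrix_mul_assoc matrix_mul_rid)
  then show ?thesis
    by (simp add: P_def matrix_mul_assoc)
qed

text \<open>An eigenvector for a root \<open>x\<close> of \<open>p z\<close> is scaled by
  \<open>poly (q z) x\<close>, which is nonzero.\<close>

lemma G_nonzero:
  assumes z: "z \<in> D"
  shows "G z \<noteq> 0"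
proof -
  obtain x where x: "poly (p z) x = 0"
    using root_of_p[OF z] .
  then have "poly (charpoly (F z)) x = 0"
    by (subst charpoly_eq[OF z]) simp
  then obtain v where v: "v \<noteq> 0" "F z *v v = x *s v"
    using eigenvector_of_charpoly_root by blast
  have "G z *v v = poly (q z) x *s v"
    unfolding G_def by (rule matrix_poly_eigenvector[OF v(2)])
  also have "\<dots> \<noteq> 0"
    using v(1) p_q_no_common_root[OF z x] by simp
  finally show ?thesis
    by auto
qed

lemma H_nonzero: "z \<in> D \<Longrightarrow> H z \<noteq> 0"
  using eigenvalue_partition.G_nonzero[OF swap]
  by (simp add: H_def p_def eigenvalue_partition.G_def[OF swap] eigenvalue_partition.q_def[OF swap])

lemma P_nonzero:
  assumes "z \<in> D"
  shows "P z \<noteq> 0"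
proof
  assume "P z = 0"
  then have "P z ** (G z + H z) = 0"
    by simp
  then have "G z = 0"
    using invertible_matrix_inv(2)[OF invertible_GH[OF assms]]
    by (simp add: P_def flip: matrix_mul_assoc)
  then show False
    using G_nonzero[OF assms] by simp
qed

text \<open>A surjective square matrix has a left inverse, so \<open>P z ** H z = 0\<close> would
  force \<open>H z = 0\<close>.\<close>

lemma P_not_surj:
  assumes "z \<in> D"
  shows "\<not> surj ((*v) (P z))"
proof
  assume "surj ((*v) (P z))"
  then obtain B where "B ** P z = mat 1"
    using matrix_right_invertible_surjective matrix_left_right_inverse by metis
  then have "H z = B ** (P z ** H z)"
    by (simp add: matrix_mul_assoc)
  then show False
    using P_H[OF assms] H_nonzero[OF assms] by simp
qed

end

section \<open>Adjoints and unitary matrices\<close>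

lemma adj_adj [simp]: "adj (adj A) = A"
  by (simp add: adj_def vec_eq_iff)

lemma adj_mult: "adj (A ** B) = adj B ** adj A"
  by (simp add: adj_def vec_eq_iff matrix_matrix_mult_def mult.commute)

text \<open>The diagonal entries of the product are the squared norms of the columns of
  \<open>A\<close>.\<close>

lemma adj_mult_self_eq_0:
  assumes "adj A ** A = 0"
  shows "A = 0"
proof -
  have "A $ i $ j = 0" for i j
  proof -
    have "(\<Sum>k\<in>UNIV. cnj (A $ k $ j) * A $ k $ j) = (adj A ** A) $ j $ j"
      by (simp add: adj_def matrix_matrix_mult_def)
    also have "\<dots> = 0"
      by (simp add: assms)
    finally have "complex_of_real (\<Sum>k\<in>UNIV. (norm (A $ k $ j))\<^sup>2) = 0"
      by (simp only: of_real_sum complex_norm_square mult.commute)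
    then have "(\<Sum>k\<in>UNIV. (norm (A $ k $ j))\<^sup>2) = 0"
      by (simp only: of_real_eq_0_iff)
    then show ?thesis
      by (simp add: sum_nonneg_eq_0_iff)
  qed
  then show ?thesis
    by (simp add: vec_eq_iff)
qed

lemma matrix_diff_ldistrib: "A ** (B - C) = A ** B - A ** (C :: 'a::ring_1^'n^'m)"
  by (simp add: matrix_matrix_mult_def vec_eq_iff sum_subtractf right_diff_distrib)

lemma matrix_diff_rdistrib: "(A - B) ** C = A ** C - B ** (C :: 'a::ring_1^'n^'m)"
  by (simp add: matrix_matrix_mult_def vec_eq_iff sum_subtractf left_diff_distrib)

text \<open>For \<open>Q = P - adj P ** P\<close>, normality and idempotence give
  \<open>adj Q ** Q = 0\<close>. Hence \<open>P = adj P ** P\<close>, which is Hermitian.\<close>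

lemma normal_idempotent_hermitian:
  assumes idem: "P ** P = P" and normal: "P ** adj P = adj P ** P"
  shows "adj P = P"
proof -
  have idem': "adj P ** adj P = adj P"
    using arg_cong[OF idem, of adj] by (simp add: adj_mult)
  let ?Q = "P - adj P ** P"
  have adjQ: "adj ?Q = adj P - adj P ** P"
    using adj_mult[of "adj P" P] by (simp add: adj_def vec_eq_iff)
  have "adj ?Q ** ?Q = adj P ** P - adj P ** adj P ** P - (adj P ** P ** P - adj P ** P ** adj P ** P)"
    unfolding adjQ by (simp add: matrix_diff_ldistrib matrix_diff_rdistrib matrix_mul_assoc)
  also have "adj P ** P ** adj P ** P = adj P ** (P ** adj P) ** P"
    by (simp add: matrix_mul_assoc)
  also have "\<dots> = (adj P ** adj P) ** (P ** P)"
    by (simp only: normal matrix_mul_assoc)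
  also have "adj P ** P ** P = adj P ** (P ** P)"
    by (simp add: matrix_mul_assoc)
  finally have "adj ?Q ** ?Q = 0"
    by (simp add: idem idem')
  then have "P = adj P ** P"
    using adj_mult_self_eq_0[of ?Q] by simp
  then show ?thesis
    by (metis adj_adj adj_mult)
qed

lemma unitary_adj: "unitary A \<Longrightarrow> unitary (adj A)"
  by (simp add: unitary_def)

lemma unitary_mult:
  assumes "unitary A" "unitary B"
  shows "unitary (A ** B)"
proof -
  have "A ** B ** (adj B ** adj A) = A ** (B ** adj B) ** adj A"
    "adj B ** adj A ** (A ** B) = adj B ** (adj A ** A) ** B"
    by (simp_all only: matrix_mul_assoc)
  then show ?thesis
    using assms by (simp add: unitary_def adj_mult)
qed

lemma unitary_diag:
  assumes "\<And>i. norm (d i) = 1"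
  shows "unitary (diag d)"
proof -
  have *: "d i * cnj (d i) = 1" for i
    using assms complex_norm_square[of "d i"] by simp
  then have "cnj (d i) * d i = 1" for i
    by (simp add: mult.commute)
  with * show ?thesis
    by (auto simp: unitary_def diag_def adj_def vec_eq_iff mat_def matrix_matrix_mult_def
        mult_delta_left mult_delta_right)
qed

text \<open>Taking adjoints of the commutation relation shows that \<open>P\<close> commutes with
  \<open>adj A\<close> as well.\<close>

lemma reducing_subspace_range:
  assumes "P ** A = A ** P" "adj P = P"
  shows "reducing_subspace A (range ((*v) P))"
proof -
  have "adj A ** P = P ** adj A"
    using arg_cong[OF assms(1), of adj] by (simp add: adj_mult assms(2))
  then have "adj A *v (P *v x) = P *v (adj A *v x)" for x
    by (simp add: matrix_vector_mul_assoc)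
  moreover have "A *v (P *v x) = P *v (A *v x)" for x
    by (simp add: matrix_vector_mul_assoc assms(1))
  moreover have "vec.subspace (range ((*v) P))"
    by (intro vec.linear_subspace_image matrix_vector_mul_linear_gen vec.subspace_UNIV)
  ultimately show ?thesis
    unfolding reducing_subspace_def by auto
qed

context eigenvalue_partition
begin

text \<open>A unitary \<open>F z\<close> commutes with its adjoint, hence so does
  \<open>P z\<close>. Taking adjoints, \<open>adj (P z)\<close> commutes with \<open>F z\<close> and
  therefore with \<open>P z\<close>: the idempotent is normal.\<close>

lemma P_hermitian:
  assumes z: "z \<in> D" and "unitary (F z)"
  shows "adj (P z) = P z"
proof (rule normal_idempotent_hermitian[OF P_idempotent[OF z]])
  have "adj (F z) ** F z = F z ** adj (F z)"
    using assms(2) by (simp add: unitary_def)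
  then have "adj (F z) ** P z = P z ** adj (F z)"
    by (rule P_commute[OF z])
  then have "adj (P z) ** F z = F z ** adj (P z)"
    by (metis adj_adj adj_mult)
  then show "P z ** adj (P z) = adj (P z) ** P z"
    using P_commute[OF z] by metis
qed

end

section \<open>Analytic functions real on the unit circle\<close>

text \<open>The modulus of \<open>exp (- \<i> * f)\<close> is \<open>exp (Im f)\<close>, which
  equals 1 on the circle; the maximum principle bounds it inside.\<close>

lemma Im_nonpos_of_real_on_circle:
  assumes f: "f holomorphic_on D" and D: "cball 0 1 \<subseteq> D"
    and real: "\<And>z. norm z = 1 \<Longrightarrow> Im (f z) = 0" and z: "norm z < 1"
  shows "Im (f z) \<le> 0"
proof -
  have hol: "(\<lambda>w. exp (- \<i> * f w)) holomorphic_on cball 0 1"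
    using holomorphic_on_subset[OF f D] by (intro holomorphic_intros)
  have "norm (exp (- \<i> * f z)) \<le> 1"
  proof (rule maximum_modulus_frontier[where S = "cball 0 1" and f = "\<lambda>w. exp (- \<i> * f w)"])
    show "norm (exp (- \<i> * f w)) \<le> 1" if "w \<in> frontier (cball 0 1)" for w
      using that by (simp add: real frontier_cball)
    show "(\<lambda>w. exp (- \<i> * f w)) holomorphic_on interior (cball 0 1)"
      using hol interior_subset holomorphic_on_subset by blast
    show "continuous_on (closure (cball 0 1)) (\<lambda>w. exp (- \<i> * f w))"
      using hol by (simp add: holomorphic_on_imp_continuous_on)
  qed (use z in auto)
  then show ?thesis
    by simp
qed

text \<open>The preceding bound for \<open>f\<close> and \<open>- f\<close> makes \<open>f\<close>
  real on the disk. A real image contains no open disk, so the open mapping theorem leaves only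
  constants on the connected set \<open>D\<close>.\<close>

lemma constant_of_real_on_circle:
  assumes f: "f holomorphic_on D" and D: "open D" "connected D" "cball 0 1 \<subseteq> D"
    and real: "\<And>z. norm z = 1 \<Longrightarrow> Im (f z) = 0"
  obtains c where "\<And>z. z \<in> D \<Longrightarrow> f z = c"
proof -
  have "Im (f z) = 0" if "norm z < 1" for z
    using Im_nonpos_of_real_on_circle[of f D z] Im_nonpos_of_real_on_circle[of "\<lambda>z. - f z" D z]
      f D real that by (force intro: holomorphic_intros)
  then have sub: "f ` ball 0 1 \<subseteq> \<real>"
    by (auto simp: complex_is_Real_iff)
  have "f constant_on D"
  proof (rule ccontr)
    assume "\<not> f constant_on D"
    then have "open (f ` ball 0 1)"
      by (intro open_mapping_thm[OF f]) (use D in auto)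
    then obtain e where e: "e > 0" "ball (f 0) e \<subseteq> f ` ball 0 1"
      by (metis centre_in_ball image_eqI less_numeral_extra(1) open_contains_ball)
    have "f 0 \<in> \<real>"
      using sub by auto
    moreover have "f 0 + \<i> * of_real (e / 2) \<in> \<real>"
      using e sub by (force simp: dist_norm norm_mult)
    ultimately show False
      using e by (simp add: complex_is_Real_iff)
  qed
  then show ?thesis
    using that by (auto simp: constant_on_def)
qed

text \<open>On the circle the entries at \<open>(i, j)\<close> and \<open>(j, i)\<close> are
  conjugate, so their sum and \<i> times their difference are real there. These two constants
  determine the entry.\<close>

lemma matrix_constant_of_hermitian_on_circle:
  fixes P :: "complex \<Rightarrow> complex^'n^'n"
  assumes hol: "\<And>i j. (\<lambda>z. P z $ i $ j) holomorphic_on D"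
    and D: "open D" "connected D" "cball 0 1 \<subseteq> D"
    and herm: "\<And>z. norm z = 1 \<Longrightarrow> adj (P z) = P z"
    and "z \<in> D" "w \<in> D"
  shows "P z = P w"
proof -
  have "P z $ i $ j = P w $ i $ j" for i j
  proof -
    have swapped: "P z $ j $ i = cnj (P z $ i $ j)" if "norm z = 1" for z
      using herm[OF that] by (simp add: adj_def vec_eq_iff)
    obtain c where c: "\<And>z. z \<in> D \<Longrightarrow> P z $ i $ j + P z $ j $ i = c"
      by (rule constant_of_real_on_circle[where f = "\<lambda>z. P z $ i $ j + P z $ j $ i", OF _ D])
         (auto intro: holomorphic_intros hol simp: swapped)
    obtain d where d: "\<And>z. z \<in> D \<Longrightarrow> \<i> * (P z $ i $ j - P z $ j $ i) = d"
      by (rule constant_of_real_on_circle[where f = "\<lambda>z. \<i> * (P z $ i $ j - P z $ j $ i)", OF _ D])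
         (auto intro!: holomorphic_intros hol simp: swapped)
    have "P z $ i $ j = (c - \<i> * d) / 2" if "z \<in> D" for z
    proof -
      have "\<i> * d = - (P z $ i $ j - P z $ j $ i)"
        by (simp flip: d[OF that] mult.assoc)
      then show ?thesis
        by (simp flip: c[OF that])
    qed
    from this[OF \<open>z \<in> D\<close>] this[OF \<open>w \<in> D\<close>] show ?thesis
      by (rule trans[OF _ sym])
  qed
  then show ?thesis
    by (simp add: vec_eq_iff)
qed

section \<open>The domain of a Nelson dilation\<close>

text \<open>On the circle \<open>z + a = z * cnj (1 + cnj a * z)\<close>, so numerator and
  denominator have equal modulus.\<close>

lemma norm_disk_aut:
  assumes "norm \<mu> = 1" "norm a < 1" "norm z = 1"
  shows "norm (disk_aut \<mu> a z) = 1"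
proof -
  have "z * cnj z = 1"
    using assms(3) complex_norm_square[of z] by simp
  then have "z + a = z * cnj (1 + cnj a * z)"
    by (simp add: algebra_simps)
  then have "norm (z + a) = norm (1 + cnj a * z)"
    using assms(3) by (simp add: norm_mult flip: complex_cnj_add)
  moreover have "1 + cnj a * z \<noteq> 0"
  proof
    assume "1 + cnj a * z = 0"
    then have "norm (cnj a * z) = 1"
      by (metis add.commute add_eq_0_iff norm_minus_cancel norm_one)
    then show False
      using assms by (simp add: norm_mult)
  qed
  ultimately show ?thesis
    using assms(1) by (simp add: disk_aut_def norm_mult norm_divide)
qed

text \<open>The pole has modulus \<open>1 / norm a\<close>. The product form of the hypothesis
  covers \<open>a = 0\<close> with any radius.\<close>

lemma disk_aut_analytic:
  assumes "norm a * r \<le> 1"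
  shows "disk_aut \<mu> a analytic_on ball 0 r"
proof -
  have "1 + cnj a * z \<noteq> 0" if "z \<in> ball 0 r" for z
  proof
    assume "1 + cnj a * z = 0"
    then have *: "norm a * norm z = 1"
      by (metis add.commute add_eq_0_iff complex_mod_cnj norm_minus_cancel norm_mult norm_one)
    then have "norm a > 0"
      by (cases "a = 0") auto
    then have "norm a * norm z < norm a * r"
      using that by simp
    with * assms show False
      by simp
  qed
  then have "(\<lambda>z. \<mu> * ((z + a) / (1 + cnj a * z))) analytic_on ball 0 r"
    by (intro analytic_intros) auto
  then show ?thesis
    by (simp add: disk_aut_def[abs_def])
qed

lemma open_nelson_domain: "open (nelson_domain \<mu> a)"
  unfolding nelson_domain_def by auto

text \<open>The disks in the union are nested, so two points and the segment between them lie in the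
  larger of two disks; the domain is convex.\<close>

lemma connected_nelson_domain: "connected (nelson_domain \<mu> a)"
proof -
  have "closed_segment x y \<subseteq> nelson_domain \<mu> a"
    if xy: "x \<in> nelson_domain \<mu> a" "y \<in> nelson_domain \<mu> a" for x y
  proof -
    obtain r1 r2 where
      "x \<in> ball 0 r1" "\<forall>i. disk_aut (\<mu> i) (a i) analytic_on ball 0 r1"
      "y \<in> ball 0 r2" "\<forall>i. disk_aut (\<mu> i) (a i) analytic_on ball 0 r2"
      using xy unfolding nelson_domain_def by blast
    then have "x \<in> ball 0 (max r1 r2)" "y \<in> ball 0 (max r1 r2)"
      and "\<forall>i. disk_aut (\<mu> i) (a i) analytic_on ball 0 (max r1 r2)"
      by (auto simp: max_def)
    moreover from this have "closed_segment x y \<subseteq> ball 0 (max r1 r2)"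
      by (intro closed_segment_subset convex_ball)
    ultimately show ?thesis
      unfolding nelson_domain_def by blast
  qed
  then show ?thesis
    by (simp add: convex_connected convex_contains_segment)
qed

lemma cball_subset_nelson_domain:
  fixes a :: "'n::finite \<Rightarrow> complex"
  assumes "\<And>i. norm (a i) < 1"
  shows "cball 0 1 \<subseteq> nelson_domain \<mu> a"
proof -
  \<comment> \<open>With \<open>m < 1\<close> the largest modulus of the \<open>a i\<close>, the
    radius \<open>2 / (1 + m)\<close> exceeds 1 but reaches no pole.\<close>
  define m where "m = Max (range (\<lambda>i. norm (a i)))"
  have m: "norm (a i) \<le> m" for i
    by (simp add: m_def)
  have "m < 1"
    using assms by (simp add: m_def)
  moreover have "0 \<le> m"
    using m norm_ge_zero order.trans by blast
  ultimately have r: "2 / (1 + m) > 1" "m * (2 / (1 + m)) \<le> 1"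
    by (simp_all add: field_simps)
  have "disk_aut (\<mu> i) (a i) analytic_on ball 0 (2 / (1 + m))" for i
  proof (rule disk_aut_analytic)
    have "norm (a i) * (2 / (1 + m)) \<le> m * (2 / (1 + m))"
      using \<open>0 \<le> m\<close> by (intro mult_right_mono m) simp
    then show "norm (a i) * (2 / (1 + m)) \<le> 1"
      using r by simp
  qed
  then have "ball 0 (2 / (1 + m)) \<subseteq> nelson_domain \<mu> a"
    unfolding nelson_domain_def by blast
  moreover have "cball (0 :: complex) 1 \<subseteq> ball 0 (2 / (1 + m))"
    using r by (auto simp del: less_divide_eq_1_pos)
  ultimately show ?thesis
    by blast
qed

lemma disk_aut_holomorphic_on_nelson_domain:
  "disk_aut (\<mu> i) (a i) holomorphic_on nelson_domain \<mu> a"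
proof -
  have "disk_aut (\<mu> i) (a i) analytic_on nelson_domain \<mu> a"
    unfolding nelson_domain_def analytic_on_Union by blast
  then show ?thesis
    by (rule analytic_imp_holomorphic)
qed

lemma nelson_dilation_holomorphic:
  "(\<lambda>z. nelson_dilation U V \<mu> a z $ i $ j) holomorphic_on nelson_domain \<mu> a"
proof -
  have "(\<lambda>z. diag (\<lambda>i. disk_aut (\<mu> i) (a i) z) $ i $ j) holomorphic_on nelson_domain \<mu> a" for i j
    by (cases "i = j") (simp_all add: diag_def disk_aut_holomorphic_on_nelson_domain holomorphic_on_const)
  then show ?thesis
    unfolding nelson_dilation_def by (intro holomorphic_on_matrix_mult) (auto intro: holomorphic_intros)
qed

lemma nelson_dilation_unitary:
  assumes "nelson_data T U V s \<mu> a" "norm z = 1"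
  shows "unitary (nelson_dilation U V \<mu> a z)"
  using assms unfolding nelson_dilation_def nelson_data_def
  by (intro unitary_mult unitary_diag unitary_adj norm_disk_aut) auto

theorem theorem1p3:
  fixes T U V :: "complex^'n^'n" and s \<mu> a :: "'n \<Rightarrow> complex"
  assumes "onorm (\<lambda>x. T *v x) < 1"
    and "nelson_data T U V s \<mu> a"
    and "fractured (nelson_domain \<mu> a) (nelson_dilation U V \<mu> a)"
  shows "eigenvalue_entangled (nelson_domain \<mu> a) (nelson_dilation U V \<mu> a) \<or>
         subspace_reducible (nelson_domain \<mu> a) (nelson_dilation U V \<mu> a)"
proof (cases "eigenvalue_entangled (nelson_domain \<mu> a) (nelson_dilation U V \<mu> a)")
  case False
  let ?D = "nelson_domain \<mu> a" and ?F = "nelson_dilation U V \<mu> a"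
  obtain k \<Lambda>1 \<Lambda>2 where "eigenvalue_partition ?D ?F k \<Lambda>1 \<Lambda>2"
    using False unfolding eigenvalue_entangled_def eigenvalue_partition_def
    using assms(3) open_nelson_domain nelson_dilation_holomorphic by blast
  then interpret eigenvalue_partition ?D ?F k \<Lambda>1 \<Lambda>2 .
  have ball: "cball 0 1 \<subseteq> ?D"
    using assms(2) by (intro cball_subset_nelson_domain) (simp add: nelson_data_def)
  then have circle: "z \<in> ?D" if "norm z = 1" for z
    using that by auto
  have herm: "adj (P z) = P z" if "norm z = 1" for z
    using circle[OF that] nelson_dilation_unitary[OF assms(2) that] by (rule P_hermitian)
  \<comment> \<open>The base point 1 lies on the circle, so the constant value is itself
    Hermitian.\<close>
  have const: "P z = P 1" if "z \<in> ?D" for z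
    using P_holomorphic open_nelson_domain connected_nelson_domain ball herm that circle[OF norm_one]
    by (rule matrix_constant_of_hermitian_on_circle)
  have "reducing_subspace (?F z) (range ((*v) (P 1)))" if "z \<in> ?D" for z
  proof (rule reducing_subspace_range)
    show "P 1 ** ?F z = ?F z ** P 1"
      using P_commute[OF that, of "?F z"] const[OF that] by simp
  qed (simp add: herm)
  moreover have "{0} \<subset> range ((*v) (P 1))"
  proof -
    have "P 1 \<noteq> 0"
      by (simp add: P_nonzero circle)
    then obtain x where "P 1 *v x \<noteq> 0"
      by (metis matrix_eq matrix_vector_mult_0)
    moreover have "0 = P 1 *v 0"
      by simp
    ultimately show ?thesis
      by blast
  qed
  moreover have "range ((*v) (P 1)) \<subset> UNIV"
    using P_not_surj[of 1] circle[of 1] by auto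
  ultimately show ?thesis
    unfolding subspace_reducible_def by blast
qed simp

end
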